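(* Let $M$ be a matroid on a finite ground set $E$ with a total ordering $<$ on $E$. Then the ordinary Tutte polynomial of $M$ has the expansion $$T_M(x,y) = \sum_{\substack{X\subseteq E \\ E\setminus X \text{ is } (M,<)\text{-compatible}}} (x-1)^{r(M/X)}\,y^{r^*(M|X)}.$$
   Context: $r(N)$ is the rank of a matroid $N$, and $N^*$ is its dual. $M|X$ is the restriction of $M$ to $X$ (ground set $X$), $M/X$ is the contraction of $M$ by $X$ (ground set $E\setminus X$), and $r^*(M|X)$ denotes the rank of the dual matroid $(M|X)^*$. $X\cup e$ means $X\cup\{e\}$. Compatibility: a set $Y\subseteq E$ is $(M,<)$-compatible if there is no circuit $C$ of $M$ with $Y\cap C=\{\min(C)\}$, where the minimum is with respect to $<$. Tutte polynomial: for a matroid $M$ with set of bases $\mathcal{B}$, $$T_M(x,y) = \sum_{B\in\mathcal{B}} x^{|\mathrm{Int}_M(B)|}\,y^{|\mathrm{Ext}_M(B)|},$$ where, for $X\subseteq E$, $$\mathrm{Int}_M(X) := \{e\in X : (E\setminus X)\cup e \text{ contains a circuit of } M^* \text{ with } e \text{ as its minimal element}\},$$ $$\mathrm{Ext}_M(X) := \{e\in E\setminus X : X\cup e \text{ contains a circuit of } M \text{ with } e \text{ as its minimal element}\}.$$ *)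

theory Defs
  imports Main
begin

text \<open>Finite matroids, presented by their independent sets.  As usual for record-based
  structures, the operations are defined on the raw record and the axioms form a separate locale.\<close>

record 'a pre_matroid =
  ground :: "'a set"
  indeps :: "'a set set"

locale matroid =
  fixes M :: "'a pre_matroid"
  assumes finite_ground: "finite (ground M)"
    and indeps_subset_ground: "I \<in> indeps M \<Longrightarrow> I \<subseteq> ground M"
    and empty_indep: "{} \<in> indeps M"
    and indep_subset: "I \<in> indeps M \<Longrightarrow> J \<subseteq> I \<Longrightarrow> J \<in> indeps M"
    and augment: "I \<in> indeps M \<Longrightarrow> J \<in> indeps M \<Longrightarrow> card I < card J
      \<Longrightarrow> \<exists>e\<in>J - I. insert e I \<in> indeps M"

definition basis :: "'a pre_matroid \<Rightarrow> 'a set \<Rightarrow> bool" where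
  "basis M B \<longleftrightarrow> B \<in> indeps M \<and> (\<forall>I\<in>indeps M. B \<subseteq> I \<longrightarrow> I = B)"

definition circuit :: "'a pre_matroid \<Rightarrow> 'a set \<Rightarrow> bool" where
  "circuit M C \<longleftrightarrow> C \<subseteq> ground M \<and> C \<notin> indeps M \<and> (\<forall>D. D \<subset> C \<longrightarrow> D \<in> indeps M)"

definition rank :: "'a pre_matroid \<Rightarrow> nat" where
  "rank M = Max (card ` indeps M)"

text \<open>The bases of the dual are the complements of the bases.\<close>

definition dual :: "'a pre_matroid \<Rightarrow> 'a pre_matroid" where
  "dual M = \<lparr>ground = ground M, indeps = {I. \<exists>B. basis M B \<and> I \<subseteq> ground M - B}\<rparr>"

text \<open>Restriction and contraction are meant for subsets \<open>X\<close> of the ground set.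
  Contraction is the operation dual to deletion, \<open>M / X = (M\<^sup>* | (E - X))\<^sup>*\<close>.\<close>

definition restriction :: "'a pre_matroid \<Rightarrow> 'a set \<Rightarrow> 'a pre_matroid" where
  "restriction M X = \<lparr>ground = X, indeps = {I \<in> indeps M. I \<subseteq> X}\<rparr>"

definition contraction :: "'a pre_matroid \<Rightarrow> 'a set \<Rightarrow> 'a pre_matroid" where
  "contraction M X = dual (restriction (dual M) (ground M - X))"

text \<open>Total orders on the ground set are given by their reflexive form \<open>le\<close>.\<close>

definition is_min :: "'a rel \<Rightarrow> 'a set \<Rightarrow> 'a \<Rightarrow> bool" where
  "is_min le C e \<longleftrightarrow> e \<in> C \<and> (\<forall>f\<in>C. (e, f) \<in> le)"

definition compatible :: "'a pre_matroid \<Rightarrow> 'a rel \<Rightarrow> 'a set \<Rightarrow> bool" where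
  "compatible M le Y \<longleftrightarrow>
     Y \<subseteq> ground M \<and> \<not> (\<exists>C e. circuit M C \<and> is_min le C e \<and> Y \<inter> C = {e})"

definition Int_act :: "'a pre_matroid \<Rightarrow> 'a rel \<Rightarrow> 'a set \<Rightarrow> 'a set" where
  "Int_act M le X =
     {e \<in> X. \<exists>C. circuit (dual M) C \<and> C \<subseteq> insert e (ground M - X) \<and> is_min le C e}"

definition Ext_act :: "'a pre_matroid \<Rightarrow> 'a rel \<Rightarrow> 'a set \<Rightarrow> 'a set" where
  "Ext_act M le X =
     {e \<in> ground M - X. \<exists>C. circuit M C \<and> C \<subseteq> insert e X \<and> is_min le C e}"

text \<open>The Tutte polynomial, evaluated at elements of an arbitrary commutative ring.  The polynomial
  itself is the value at the two indeterminates of \<open>int poly poly\<close>.\<close>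

definition tutte :: "'a pre_matroid \<Rightarrow> 'a rel \<Rightarrow> 'b::comm_ring_1 \<Rightarrow> 'b \<Rightarrow> 'b" where
  "tutte M le x y =
     (\<Sum>B\<in>{B. basis M B}. x ^ card (Int_act M le B) * y ^ card (Ext_act M le B))"

end

theory Submission
  imports Defs
begin

text \<open>
  With \<open>Ext(X)\<close> as in the definition of the Tutte polynomial, \<open>E - X\<close> is compatible iff
  \<open>Ext(X) = {}\<close>.  Such sets are parametrised by the pairs of a basis \<open>B\<close> and a set
  \<open>S \<subseteq> Int(B)\<close> through \<open>X = (B - S) \<union> Ext(B)\<close>.  Here \<open>B - S\<close> is a basis of \<open>M|X\<close>, so \<open>M/X\<close>
  has rank \<open>|S|\<close> and \<open>(M|X)\<^sup>*\<close> has rank \<open>|Ext(B)|\<close>, and summing \<open>(x - 1)\<^bsup>|S|\<^esup>\<close> over \<open>S\<close> gives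
  \<open>x\<^bsup>|Int(B)|\<^esup>\<close>.  The inverse is greedy: \<open>B - S\<close> consists of the elements of \<open>X\<close> not spanned by
  the larger elements of \<open>X\<close>, and \<open>S\<close> of the elements outside \<open>X\<close> not spanned by \<open>X\<close> together
  with all smaller elements of \<open>E\<close>.
\<close>

section \<open>Bases, circuits and duality\<close>

lemma ground_dual [simp]: "ground (dual M) = ground M"
  by (simp add: dual_def)

lemma ground_restriction [simp]: "ground (restriction M X) = X"
  by (simp add: restriction_def)

lemma indeps_restriction [simp]: "I \<in> indeps (restriction M X) \<longleftrightarrow> I \<in> indeps M \<and> I \<subseteq> X"
  by (auto simp: restriction_def)

lemma indeps_dual: "I \<in> indeps (dual M) \<longleftrightarrow> (\<exists>B. basis M B \<and> I \<subseteq> ground M - B)"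
  by (simp add: dual_def)

lemma basis_indep: "basis M B \<Longrightarrow> B \<in> indeps M"
  by (simp add: basis_def)

lemma basis_restrictionD:
  assumes "basis (restriction M X) I"
  shows "I \<in> indeps M" "I \<subseteq> X"
  using basis_indep[OF assms] by auto

context matroid
begin

lemma finite_indeps: "finite (indeps M)"
  by (rule finite_subset[of _ "Pow (ground M)"]) (use finite_ground indeps_subset_ground in auto)

lemma finite_indep: "I \<in> indeps M \<Longrightarrow> finite I"
  using finite_ground finite_subset indeps_subset_ground by blast

lemma extend_to_basis:
  assumes "I \<in> indeps M"
  obtains B where "basis M B" "I \<subseteq> B"
proof -
  let ?S = "{J \<in> indeps M. I \<subseteq> J}"
  have "finite ?S" "?S \<noteq> {}"
    using assms finite_indeps by auto
  then obtain B where "B \<in> ?S" "\<forall>J\<in>?S. B \<subseteq> J \<longrightarrow> B = J"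
    by (metis (lifting) finite_has_maximal)
  then have "basis M B" "I \<subseteq> B"
    unfolding basis_def by auto
  then show ?thesis ..
qed

lemma ex_basis: obtains B where "basis M B"
  using extend_to_basis[OF empty_indep] by blast

lemma card_indep_le_basis:
  assumes "I \<in> indeps M" "basis M B"
  shows "card I \<le> card B"
proof (rule ccontr)
  assume "\<not> card I \<le> card B"
  then obtain e where "e \<in> I - B" "insert e B \<in> indeps M"
    using augment[of B I] assms by (auto simp: basis_def)
  then show False
    using assms by (auto simp: basis_def)
qed

lemma card_basis_eq: "basis M B \<Longrightarrow> basis M B' \<Longrightarrow> card B = card B'"
  by (meson basis_def card_indep_le_basis order_antisym)

lemma basis_if_card_eq:
  assumes "I \<in> indeps M" "basis M B" "card B \<le> card I"
  shows "basis M I"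
  unfolding basis_def
proof (intro conjI ballI impI)
  fix J assume J: "J \<in> indeps M" "I \<subseteq> J"
  have "card J \<le> card I"
    using card_indep_le_basis[OF J(1) assms(2)] assms(3) by simp
  then show "J = I"
    using card_seteq[OF finite_indep J(2)] J(1) by simp
qed (rule assms)

lemma basis_subset_ground: "basis M B \<Longrightarrow> B \<subseteq> ground M"
  by (simp add: basis_def indeps_subset_ground)

lemma matroid_restriction: "X \<subseteq> ground M \<Longrightarrow> matroid (restriction M X)"
proof (unfold_locales, goal_cases)
  case 1
  then show ?case
    using finite_ground finite_subset by auto
next
  case (5 I J)
  then show ?case
    using augment[of I J] by auto
qed (use empty_indep indep_subset in auto)

text \<open>A basis of the restriction to \<open>I \<union> B\<close> that contains \<open>I\<close>
  has at least \<open>card B\<close> elements, because \<open>B\<close> is independent there too; so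
  it is a basis of \<open>M\<close>.\<close>

lemma extend_within_basis:
  assumes "I \<in> indeps M" "basis M B"
  obtains B' where "basis M B'" "I \<subseteq> B'" "B' \<subseteq> I \<union> B"
proof -
  interpret R: matroid "restriction M (I \<union> B)"
    by (rule matroid_restriction) (use assms indeps_subset_ground basis_subset_ground in auto)
  obtain B' where B': "basis (restriction M (I \<union> B)) B'" "I \<subseteq> B'"
    using R.extend_to_basis[of I] assms by auto
  have "card B \<le> card B'"
    using R.card_indep_le_basis[of B B'] B' assms by (auto simp: basis_def)
  moreover have "B' \<in> indeps M" "B' \<subseteq> I \<union> B"
    using B' by (auto simp: basis_def)
  ultimately show ?thesis
    using B' that basis_if_card_eq assms by blast
qed

lemma matroid_dual: "matroid (dual M)"
proof (unfold_locales, goal_cases)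
  case 3
  then show ?case
    using ex_basis by (auto simp: indeps_dual)
next
  case (5 I J)
  obtain B1 B2 where B1: "basis M B1" "I \<subseteq> ground M - B1" and B2: "basis M B2" "J \<subseteq> ground M - B2"
    using 5 by (auto simp: indeps_dual)
  have fin: "finite I" "finite J" "finite B2"
    using B1(2) B2(2) basis_subset_ground[OF B2(1)] finite_subset[OF _ finite_ground] by blast+
  \<comment> \<open>Only augmentation takes work. Extending \<open>B2 - I\<close> by elements of
    \<open>B1\<close> gives a basis \<open>B3\<close> that avoids \<open>I\<close>. If
    \<open>B3\<close> contained \<open>J - I\<close>, comparing its size with \<open>B2\<close>,
    which avoids \<open>J\<close>, would contradict \<open>card I < card J\<close>.\<close>
  have "B2 - I \<in> indeps M"
    using B2(1) indep_subset[of B2] by (auto simp: basis_def)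
  then obtain B3 where B3: "basis M B3" "B2 - I \<subseteq> B3" "B3 \<subseteq> (B2 - I) \<union> B1"
    using extend_within_basis B1 by blast
  have "\<not> J - I \<subseteq> B3"
  proof
    assume sub: "J - I \<subseteq> B3"
    have "card (B2 - I) + card (J - I) = card ((B2 - I) \<union> (J - I))"
      by (rule card_Un_disjoint[symmetric]) (use fin B2(2) in blast)+
    also have "\<dots> \<le> card B3"
      by (rule card_mono) (use B3(1,2) sub finite_indep[of B3] in \<open>auto simp: basis_def\<close>)
    finally have "card (B2 - I) + card (J - I) \<le> card B2"
      using card_basis_eq[OF B2(1) B3(1)] by simp
    moreover have "card B2 = card (B2 - I) + card (B2 \<inter> I)"
      by (metis add.commute card_Int_Diff fin(3))
    moreover have "card (B2 \<inter> I) \<le> card (I - J)"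
      by (rule card_mono) (use fin B2(2) 5 in blast)+
    moreover have "card I = card (I \<inter> J) + card (I - J)" "card J = card (I \<inter> J) + card (J - I)"
      using card_Int_Diff[OF fin(1), of J] card_Int_Diff[OF fin(2), of I] by (simp_all add: Int_commute)
    ultimately show False
      using 5 by linarith
  qed
  then obtain e where e: "e \<in> J - I" "e \<notin> B3"
    by blast
  have "insert e I \<subseteq> ground M - B3"
    using B1(2) B2(2) B3(3) e by blast
  then show ?case
    using B3(1) e(1) indeps_dual by blast
next
  case (4 I J)
  then show ?case
    unfolding indeps_dual by blast
qed (use finite_ground in \<open>auto simp: indeps_dual\<close>)

lemma rank_eq_card_basis:
  assumes "basis M B"
  shows "rank M = card B"
  unfolding rank_def
  by (rule Max_eqI) (use assms finite_indeps card_indep_le_basis in \<open>auto simp: basis_def\<close>)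

lemma basis_dual:
  assumes "basis M B"
  shows "basis (dual M) (ground M - B)"
  unfolding basis_def
proof (intro conjI ballI impI)
  show "ground M - B \<in> indeps (dual M)"
    using assms by (auto simp: indeps_dual)
next
  fix I assume I: "I \<in> indeps (dual M)" "ground M - B \<subseteq> I"
  then obtain B' where B': "basis M B'" "I \<subseteq> ground M - B'"
    by (auto simp: indeps_dual)
  have "B' \<subseteq> B"
    using I B' basis_subset_ground by blast
  then have "B' = B"
    using assms B' by (auto simp: basis_def)
  then show "I = ground M - B"
    using I B' by auto
qed

lemma rank_dual:
  assumes "basis M B"
  shows "rank (dual M) = card (ground M - B)"
  using matroid.rank_eq_card_basis[OF matroid_dual] basis_dual[OF assms] by simp

text \<open>Since contraction is defined by two dualizations, it suffices that
  \<open>ground M - X - B\<close> is a basis of the dual restricted to \<open>ground M - X\<close>.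
  Any competitor \<open>K\<close> there avoids a basis \<open>B'\<close>, and \<open>B'\<close> has
  at most as many elements in \<open>X\<close> as \<open>B\<close>, hence at least as many
  outside.\<close>

lemma rank_contraction:
  assumes X: "X \<subseteq> ground M" and B: "basis M B" and BX: "basis (restriction M X) (B \<inter> X)"
  shows "rank (contraction M X) = card (B - X)"
proof -
  interpret D: matroid "dual M"
    by (rule matroid_dual)
  interpret R: matroid "restriction (dual M) (ground M - X)"
    by (rule D.matroid_restriction) auto
  interpret RX: matroid "restriction M X"
    by (rule matroid_restriction) (rule X)
  have finB: "finite B" and subB: "B \<subseteq> ground M"
    using B finite_indep basis_indep basis_subset_ground by blast+
  let ?J = "ground M - X - B"
  have J: "?J \<in> indeps (restriction (dual M) (ground M - X))"
    using B indeps_restriction indeps_dual by blast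
  obtain K where K: "basis (restriction (dual M) (ground M - X)) K"
    using R.ex_basis by blast
  then obtain B' where B': "basis M B'" "K \<subseteq> ground M - X - B'"
    using basis_restrictionD[OF K] unfolding indeps_dual by blast
  have finB': "finite B'" and subB': "B' \<subseteq> ground M"
    using B'(1) finite_indep basis_indep basis_subset_ground by blast+
  have "B' \<inter> X \<in> indeps (restriction M X)"
    using basis_indep[OF B'(1)] indep_subset[of B' "B' \<inter> X"] by simp
  then have "card (B' \<inter> X) \<le> card (B \<inter> X)"
    using RX.card_indep_le_basis BX by blast
  moreover have "card B = card B'"
    using card_basis_eq B B' by blast
  ultimately have le: "card (B - X) \<le> card (B' - X)"
    using card_Int_Diff[of B X] card_Int_Diff[of B' X] finB finB' by linarith
  have split: "card (ground M - X) = card (C - X) + card (ground M - X - C)" if "C \<subseteq> ground M" for C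
  proof -
    have "card (ground M - X) = card ((ground M - X) \<inter> C) + card (ground M - X - C)"
      by (rule card_Int_Diff) (use finite_ground in auto)
    moreover have "(ground M - X) \<inter> C = C - X"
      using that by auto
    ultimately show ?thesis
      by simp
  qed
  have "card K \<le> card (ground M - X - B')"
    by (rule card_mono) (use B'(2) finite_ground in auto)
  also have "\<dots> \<le> card ?J"
    using le split[OF subB] split[OF subB'] by linarith
  finally have "basis (restriction (dual M) (ground M - X)) ?J"
    using R.basis_if_card_eq[OF J K] by blast
  then have "rank (contraction M X) = card (ground M - X - ?J)"
    using R.rank_dual by (simp add: contraction_def)
  also have "ground M - X - ?J = B - X"
    using subB by auto
  finally show ?thesis .
qed

lemma ex_circuit:
  assumes "A \<subseteq> ground M" "A \<notin> indeps M"
  obtains C where "circuit M C" "C \<subseteq> A"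
proof -
  let ?S = "{D. D \<subseteq> A \<and> D \<notin> indeps M}"
  have "finite ?S" "?S \<noteq> {}"
    using assms finite_ground by (auto simp: finite_subset)
  then obtain C where "C \<in> ?S" "\<forall>D\<in>?S. D \<subseteq> C \<longrightarrow> C = D"
    by (metis (lifting) finite_has_minimal)
  then have "circuit M C" "C \<subseteq> A"
    using assms unfolding circuit_def by auto
  then show ?thesis ..
qed

lemma circuit_subset_ground: "circuit M C \<Longrightarrow> C \<subseteq> ground M"
  by (simp add: circuit_def)

lemma circuit_not_indep: "circuit M C \<Longrightarrow> C \<subseteq> I \<Longrightarrow> I \<in> indeps M \<Longrightarrow> False"
  using indep_subset by (auto simp: circuit_def)

lemma ex_circuit_insert:
  assumes "I \<in> indeps M" "e \<in> ground M" "insert e I \<notin> indeps M"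
  obtains C where "circuit M C" "e \<in> C" "C \<subseteq> insert e I"
proof -
  obtain C where C: "circuit M C" "C \<subseteq> insert e I"
    using ex_circuit[of "insert e I"] assms indeps_subset_ground by blast
  moreover have "e \<in> C"
    using C circuit_not_indep assms(1) by blast
  ultimately show ?thesis
    using that by blast
qed

text \<open>Some basis \<open>B\<close> avoids \<open>D - {e}\<close>, and extending
  \<open>C - {e}\<close> by elements of \<open>B\<close> gives a basis that still avoids it. As
  \<open>D\<close> is dependent in the dual, this basis must contain \<open>e\<close>, and then all
  of \<open>C\<close>.\<close>

lemma circuit_cocircuit_orthogonal:
  assumes C: "circuit M C" and D: "circuit (dual M) D"
  shows "C \<inter> D \<noteq> {e}"
proof
  assume e: "C \<inter> D = {e}"
  then have "D - {e} \<subset> D" "C - {e} \<subset> C"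
    by auto
  then have "D - {e} \<in> indeps (dual M)" and Ce: "C - {e} \<in> indeps M"
    using C D by (auto simp: circuit_def)
  then obtain B where B: "basis M B" "D - {e} \<subseteq> ground M - B"
    by (auto simp: indeps_dual)
  obtain B' where B': "basis M B'" "C - {e} \<subseteq> B'" "B' \<subseteq> C - {e} \<union> B"
    using extend_within_basis[OF Ce B(1)] by blast
  have "D \<notin> indeps (dual M)" "D \<subseteq> ground M"
    using D by (auto simp: circuit_def)
  then have "\<not> D \<subseteq> ground M - B'"
    using B'(1) indeps_dual by blast
  moreover have "D - {e} \<subseteq> ground M - B'"
    using B(2) B'(3) e by blast
  ultimately have "e \<in> B'"
    using \<open>D \<subseteq> ground M\<close> by blast
  then have "C \<subseteq> B'"
    using B'(2) by blast
  then show False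
    using circuit_not_indep[OF C] basis_indep[OF B'(1)] by blast
qed

section \<open>Closure\<close>

text \<open>This is the usual matroid closure, phrased by circuits rather than by rank because the
  activities are given by circuits.\<close>

definition closure :: "'a set \<Rightarrow> 'a set" where
  "closure A = {e \<in> ground M. e \<in> A \<or> (\<exists>C. circuit M C \<and> e \<in> C \<and> C \<subseteq> insert e A)}"

lemma subset_closure: "A \<subseteq> ground M \<Longrightarrow> A \<subseteq> closure A"
  by (auto simp: closure_def)

lemma closure_subset_ground: "closure A \<subseteq> ground M"
  by (auto simp: closure_def)

lemma closure_mono: "A \<subseteq> A' \<Longrightarrow> closure A \<subseteq> closure A'"
  unfolding closure_def by blast

lemma circuit_in_closure: "circuit M C \<Longrightarrow> e \<in> C \<Longrightarrow> C - {e} \<subseteq> A \<Longrightarrow> e \<in> closure A"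
  unfolding closure_def circuit_def by blast

lemma closureE:
  assumes "e \<in> closure A" "e \<notin> A"
  obtains C where "circuit M C" "e \<in> C" "C - {e} \<subseteq> A"
  using assms unfolding closure_def by blast

text \<open>For \<open>e\<close> outside \<open>F\<close>, take a circuit \<open>C\<close> putting
  \<open>e\<close> in the closure and extend \<open>C - {e}\<close> to a basis \<open>J\<close> of
  the restriction to \<open>F\<close>. If \<open>insert e I\<close> were independent, it would
  augment \<open>J\<close>; maximality of \<open>J\<close> in \<open>F\<close> leaves only
  \<open>e\<close> to add, which completes \<open>C\<close>.\<close>

lemma insert_dependent_closure_basis:
  assumes F: "F \<subseteq> ground M" and I: "basis (restriction M F) I" and e: "e \<in> closure F" "e \<notin> I"
  shows "insert e I \<notin> indeps M"
proof (cases "e \<in> F")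
  case True
  then show ?thesis
    using I e by (auto simp: basis_def)
next
  case False
  interpret R: matroid "restriction M F"
    by (rule matroid_restriction) (rule F)
  obtain C where C: "circuit M C" "e \<in> C" "C - {e} \<subseteq> F"
    using closureE[OF e(1) False] by blast
  have "C - {e} \<in> indeps M"
    using C(1,2) unfolding circuit_def by blast
  then obtain J where J: "basis (restriction M F) J" "C - {e} \<subseteq> J"
    using R.extend_to_basis[of "C - {e}"] C by auto
  show ?thesis
  proof
    assume ins: "insert e I \<in> indeps M"
    have "card J < card (insert e I)"
      using R.card_basis_eq[OF I J(1)] e(2) I R.finite_indep by (auto simp: basis_def)
    then obtain f where f: "f \<in> insert e I - J" "insert f J \<in> indeps M"
      using augment[OF _ ins, of J] J by (auto simp: basis_def)
    have "f = e"
    proof (rule ccontr)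
      assume "f \<noteq> e"
      then have "insert f J \<in> indeps (restriction M F)"
        using f I J by (auto simp: basis_def)
      then show False
        using J f by (auto simp: basis_def)
    qed
    then show False
      using circuit_not_indep[OF C(1) _ f(2)] J by auto
  qed
qed

text \<open>Transitivity of spanning. A basis of the restriction to \<open>F\<close> remains one for
  \<open>closure F\<close>, so whatever \<open>closure F\<close> spans is already spanned by that
  basis.\<close>

lemma closure_closure_subset:
  assumes F: "F \<subseteq> ground M" and A: "A \<subseteq> closure F"
  shows "closure A \<subseteq> closure F"
proof
  fix e assume "e \<in> closure A"
  then have e: "e \<in> closure (closure F)"
    using closure_mono[OF A] by blast
  interpret R: matroid "restriction M F"
    by (rule matroid_restriction) (rule F)
  obtain I where I: "basis (restriction M F) I"
    using R.ex_basis by blast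
  then have IF: "I \<in> indeps M" "I \<subseteq> F"
    by (rule basis_restrictionD)+
  have "basis (restriction M (closure F)) I"
    unfolding basis_def
  proof (intro conjI ballI impI)
    show "I \<in> indeps (restriction M (closure F))"
      using IF subset_closure[OF F] by auto
    fix J assume J: "J \<in> indeps (restriction M (closure F))" "I \<subseteq> J"
    show "J = I"
    proof (rule ccontr)
      assume "J \<noteq> I"
      then obtain f where f: "f \<in> J" "f \<notin> I"
        using J by auto
      then have "insert f I \<in> indeps M"
        using J indep_subset[of J "insert f I"] by auto
      then show False
        using insert_dependent_closure_basis[OF F I _ f(2)] f(1) J(1) by auto
    qed
  qed
  then have "e \<in> I \<or> insert e I \<notin> indeps M"
    using insert_dependent_closure_basis[OF closure_subset_ground _ e] by blast
  moreover have "e \<in> ground M"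
    using e closure_subset_ground by blast
  ultimately show "e \<in> closure F"
  proof (elim disjE)
    assume "insert e I \<notin> indeps M"
    then obtain C where "circuit M C" "e \<in> C" "C \<subseteq> insert e I"
      using ex_circuit_insert[OF IF(1) \<open>e \<in> ground M\<close>] by blast
    then show ?thesis
      using circuit_in_closure[of C e F] IF(2) by blast
  qed (use IF(2) subset_closure[OF F] in blast)
qed

lemma basis_restriction_if_spanning:
  assumes "I \<in> indeps M" "I \<subseteq> X" "X \<subseteq> closure I"
  shows "basis (restriction M X) I"
  unfolding basis_def
proof (intro conjI ballI impI)
  show "I \<in> indeps (restriction M X)"
    using assms by simp
  fix J assume J: "J \<in> indeps (restriction M X)" "I \<subseteq> J"
  show "J = I"
  proof (rule ccontr)
    assume "J \<noteq> I"
    then obtain f where f: "f \<in> J" "f \<notin> I"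
      using J by auto
    then have "f \<in> closure I"
      using assms(3) J(1) by auto
    then obtain C where "circuit M C" "C - {f} \<subseteq> I"
      using closureE f(2) by blast
    then show False
      using circuit_not_indep[of C J] f(1) J by auto
  qed
qed

lemma indep_not_in_closure:
  assumes "B \<in> indeps M" "e \<in> B" "e \<notin> A" "A \<subseteq> B"
  shows "e \<notin> closure A"
proof
  assume "e \<in> closure A"
  then obtain C where "circuit M C" "C - {e} \<subseteq> A"
    using closureE assms(3) by blast
  then show False
    using circuit_not_indep[of C B] assms by auto
qed

lemma basis_spanning:
  assumes "basis M B"
  shows "closure B = ground M"
proof
  show "ground M \<subseteq> closure B"
  proof
    fix e assume e: "e \<in> ground M"
    have B: "B \<in> indeps M"
      using assms by (simp add: basis_def)
    show "e \<in> closure B"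
    proof (cases "e \<in> B")
      case False
      then have "insert e B \<notin> indeps M"
        using assms unfolding basis_def by blast
      then obtain C where "circuit M C" "e \<in> C" "C \<subseteq> insert e B"
        using ex_circuit_insert[OF B e] by blast
      then show ?thesis
        using circuit_in_closure[of C e B] by blast
    qed (use e in \<open>simp add: closure_def\<close>)
  qed
qed (rule closure_subset_ground)

end

locale ordered_matroid = matroid M for M :: "'a pre_matroid" +
  fixes le :: "'a rel"
  assumes linear_order: "linear_order_on (ground M) le"
begin

section \<open>Activities\<close>

text \<open>Strict upper sets: \<open>e\<close> is the minimum of a circuit \<open>C\<close> through
  \<open>e\<close> exactly when \<open>C - {e}\<close> lies in \<open>above e\<close>.\<close>

definition above :: "'a \<Rightarrow> 'a set" where
  "above e = {f \<in> ground M. (e, f) \<in> le \<and> f \<noteq> e}"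

definition below :: "'a \<Rightarrow> 'a set" where
  "below e = {f \<in> ground M. (f, e) \<in> le \<and> f \<noteq> e}"

lemma le_refl: "e \<in> ground M \<Longrightarrow> (e, e) \<in> le"
  using linear_order
  by (auto simp: linear_order_on_def partial_order_on_def preorder_on_def refl_on_def)

lemma le_trans: "(e, f) \<in> le \<Longrightarrow> (f, g) \<in> le \<Longrightarrow> (e, g) \<in> le"
  using linear_order
  unfolding linear_order_on_def partial_order_on_def preorder_on_def by (meson transD)

lemma le_antisym: "(e, f) \<in> le \<Longrightarrow> (f, e) \<in> le \<Longrightarrow> e = f"
  using linear_order
  unfolding linear_order_on_def partial_order_on_def by (meson antisymD)

lemma le_total: "e \<in> ground M \<Longrightarrow> f \<in> ground M \<Longrightarrow> (e, f) \<in> le \<or> (f, e) \<in> le"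
  using linear_order le_refl unfolding linear_order_on_def total_on_def by metis

lemma above_subset_ground: "above e \<subseteq> ground M"
  by (auto simp: above_def)

lemma below_subset_ground: "below e \<subseteq> ground M"
  by (auto simp: below_def)

lemma above_trans: "f \<in> above e \<Longrightarrow> g \<in> above f \<Longrightarrow> g \<in> above e"
  unfolding above_def using le_trans le_antisym by blast

lemma above_not_below: "f \<in> above e \<Longrightarrow> f \<in> below e \<Longrightarrow> False"
  unfolding above_def below_def using le_antisym by blast

lemma below_iff_above: "e \<in> ground M \<Longrightarrow> f \<in> ground M \<Longrightarrow> f \<in> below e \<longleftrightarrow> e \<in> above f"
  unfolding above_def below_def by blast

lemma above_or_below:
  "e \<in> ground M \<Longrightarrow> f \<in> ground M \<Longrightarrow> f = e \<or> f \<in> above e \<or> f \<in> below e"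
  unfolding above_def below_def using le_total by blast

lemma ex_le_minimum:
  assumes "A \<subseteq> ground M" "A \<noteq> {}"
  obtains m where "m \<in> A" "A - {m} \<subseteq> above m"
proof -
  have "finite A"
    using assms(1) finite_ground finite_subset by blast
  then have "\<exists>m\<in>A. \<forall>a\<in>A. (m, a) \<in> le"
    using assms(2,1)
  proof (induction A rule: finite_ne_induct)
    case (singleton x)
    then show ?case
      using le_refl by blast
  next
    case (insert x F)
    then obtain m where m: "m \<in> F" "\<forall>a\<in>F. (m, a) \<in> le"
      by blast
    then have "(m, x) \<in> le \<or> (x, m) \<in> le"
      using insert.prems le_total by blast
    then show ?case
      using m le_trans le_refl insert.prems by blast
  qed
  then show ?thesis
    using that assms(1) unfolding above_def by blast
qed

lemma ex_le_maximum:
  assumes "A \<subseteq> ground M" "A \<noteq> {}"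
  obtains m where "m \<in> A" "A - {m} \<subseteq> below m"
proof -
  have "finite A"
    using assms(1) finite_ground finite_subset by blast
  then have "\<exists>m\<in>A. \<forall>a\<in>A. (a, m) \<in> le"
    using assms(2,1)
  proof (induction A rule: finite_ne_induct)
    case (singleton x)
    then show ?case
      using le_refl by blast
  next
    case (insert x F)
    then obtain m where m: "m \<in> F" "\<forall>a\<in>F. (a, m) \<in> le"
      by blast
    then have "(m, x) \<in> le \<or> (x, m) \<in> le"
      using insert.prems le_total by blast
    then show ?case
      using m le_trans le_refl insert.prems by blast
  qed
  then show ?thesis
    using that assms(1) unfolding below_def by blast
qed

lemma is_min_iff: "C \<subseteq> ground M \<Longrightarrow> is_min le C e \<longleftrightarrow> e \<in> C \<and> C - {e} \<subseteq> above e"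
  unfolding is_min_def above_def using le_refl by blast

text \<open>Turns external activity into a closure condition: minimality of \<open>e\<close> pushes
  the rest of the witnessing circuit above \<open>e\<close>.\<close>

lemma mem_Ext_act_iff:
  "e \<in> Ext_act M le X \<longleftrightarrow> e \<in> ground M \<and> e \<notin> X \<and> e \<in> closure (X \<inter> above e)"
proof
  assume "e \<in> Ext_act M le X"
  then obtain C where C: "e \<in> ground M" "e \<notin> X" "circuit M C" "C \<subseteq> insert e X" "is_min le C e"
    unfolding Ext_act_def by blast
  then have "e \<in> C" "C - {e} \<subseteq> above e"
    using is_min_iff circuit_subset_ground by blast+
  then show "e \<in> ground M \<and> e \<notin> X \<and> e \<in> closure (X \<inter> above e)"
    using C circuit_in_closure[of C e "X \<inter> above e"] by blast
next
  assume e: "e \<in> ground M \<and> e \<notin> X \<and> e \<in> closure (X \<inter> above e)"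
  then obtain C where C: "circuit M C" "e \<in> C" "C - {e} \<subseteq> X \<inter> above e"
    using closureE[of e "X \<inter> above e"] by blast
  then have "is_min le C e"
    using is_min_iff[OF circuit_subset_ground[OF C(1)]] by blast
  then show "e \<in> Ext_act M le X"
    using e C unfolding Ext_act_def by blast
qed

text \<open>The counterpart in terms of \<open>M\<close> alone, without cocircuits. Forward, a
  circuit placing \<open>e\<close> in the closure would meet the cocircuit only in \<open>e\<close>,
  against orthogonality.\<close>

lemma mem_Int_act_iff:
  assumes B: "basis M B"
  shows "e \<in> Int_act M le B \<longleftrightarrow> e \<in> B \<and> e \<notin> closure ((B - {e}) \<union> below e)"
proof
  assume "e \<in> Int_act M le B"
  then obtain D where D: "e \<in> B" "circuit (dual M) D" "D \<subseteq> insert e (ground M - B)" "is_min le D e"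
    unfolding Int_act_def by blast
  have "D \<subseteq> ground M"
    using D(2) by (simp add: circuit_def)
  then have eD: "e \<in> D" "D - {e} \<subseteq> above e"
    using D(4) is_min_iff by blast+
  have "e \<notin> closure ((B - {e}) \<union> below e)"
  proof
    assume "e \<in> closure ((B - {e}) \<union> below e)"
    moreover have "e \<notin> (B - {e}) \<union> below e"
      by (simp add: below_def)
    ultimately obtain C where C: "circuit M C" "e \<in> C" "C - {e} \<subseteq> (B - {e}) \<union> below e"
      using closureE by blast
    have "C \<inter> D = {e}"
      using C(2,3) D(3) eD above_not_below by blast
    then show False
      using circuit_cocircuit_orthogonal[OF C(1) D(2)] by blast
  qed
  then show "e \<in> B \<and> e \<notin> closure ((B - {e}) \<union> below e)"
    using D(1) by blast
next
  assume e: "e \<in> B \<and> e \<notin> closure ((B - {e}) \<union> below e)"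
  interpret D: matroid "dual M"
    by (rule matroid_dual)
  have eE: "e \<in> ground M"
    using e basis_subset_ground[OF B] by blast
  \<comment> \<open>A basis avoiding \<open>?A\<close> would lie in
    \<open>(B - {e}) \<union> below e\<close> and so span \<open>e\<close>. Hence \<open>?A\<close>
    contains a cocircuit, which must pass through \<open>e\<close> because
    \<open>ground M - B\<close> is independent in the dual.\<close>
  let ?A = "insert e ((ground M - B) \<inter> above e)"
  have "?A \<notin> indeps (dual M)"
  proof
    assume "?A \<in> indeps (dual M)"
    then obtain B' where B': "basis M B'" "?A \<subseteq> ground M - B'"
      unfolding indeps_dual by blast
    have "B' \<subseteq> (B - {e}) \<union> below e"
      using B'(2) basis_subset_ground[OF B'(1)] above_or_below[OF eE] by blast
    then show False
      using basis_spanning[OF B'(1)] closure_mono e eE by blast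
  qed
  then obtain D where D: "circuit (dual M) D" "D \<subseteq> ?A"
    using D.ex_circuit[of ?A] eE by auto
  have "e \<in> D"
  proof (rule ccontr)
    assume "e \<notin> D"
    then have "D \<subseteq> ground M - B"
      using D(2) by blast
    then show False
      using D.circuit_not_indep[OF D(1) _ basis_indep[OF basis_dual[OF B]]] by blast
  qed
  moreover have "D \<subseteq> ground M" "D - {e} \<subseteq> above e"
    using D eE by (auto simp: circuit_def)
  ultimately have "is_min le D e"
    using is_min_iff by blast
  then show "e \<in> Int_act M le B"
    using e D unfolding Int_act_def by blast
qed

lemma compatible_compl_iff:
  assumes "X \<subseteq> ground M"
  shows "compatible M le (ground M - X) \<longleftrightarrow> Ext_act M le X = {}"
proof -
  have "(ground M - X) \<inter> C = {e} \<longleftrightarrow> e \<in> ground M - X \<and> C \<subseteq> insert e X"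
    if "circuit M C" "is_min le C e" for C e
    using circuit_subset_ground[OF that(1)] that(2) unfolding is_min_def by blast
  then show ?thesis
    unfolding compatible_def Ext_act_def by blast
qed

section \<open>From a basis and a set of internally active elements to a compatible set\<close>

context
  fixes B S X
  assumes B: "basis M B" and S: "S \<subseteq> Int_act M le B" and X: "X = (B - S) \<union> Ext_act M le B"
begin

lemma S_subset: "S \<subseteq> B"
  using S unfolding Int_act_def by blast

lemma X_subset: "X \<subseteq> ground M"
  using X basis_subset_ground[OF B] unfolding Ext_act_def by blast

lemma Ext_act_disjoint: "B \<inter> Ext_act M le B = {}"
  unfolding Ext_act_def by blast

text \<open>Deleting \<open>S\<close> from \<open>B\<close> does not harm external activity. An
  element \<open>s\<close> of \<open>S\<close> in the circuit that makes \<open>f\<close> active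
  would be larger than \<open>f\<close>, so the same circuit would show that \<open>s\<close> is not
  internally active.\<close>

lemma Ext_act_closure:
  assumes "f \<in> Ext_act M le B"
  shows "f \<in> closure ((B - S) \<inter> above f)"
proof -
  have f: "f \<in> ground M" "f \<notin> B" "f \<in> closure (B \<inter> above f)"
    using assms mem_Ext_act_iff by blast+
  then obtain C where C: "circuit M C" "f \<in> C" "C - {f} \<subseteq> B \<inter> above f"
    using closureE[of f "B \<inter> above f"] by blast
  have "s \<notin> S" if s: "s \<in> C - {f}" for s
  proof
    assume "s \<in> S"
    then have "s \<notin> closure ((B - {s}) \<union> below s)"
      using S mem_Int_act_iff[OF B] by blast
    moreover have "f \<in> below s"
      using s C(3) f(1) above_subset_ground below_iff_above by blast
    then have "C - {s} \<subseteq> (B - {s}) \<union> below s"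
      using C(3) by blast
    ultimately show False
      using circuit_in_closure[OF C(1), of s] s by blast
  qed
  then have "C - {f} \<subseteq> (B - S) \<inter> above f"
    using C(3) by blast
  then show ?thesis
    by (rule circuit_in_closure[OF C(1,2)])
qed

lemma X_above_closure: "X \<inter> above e \<subseteq> closure ((B - S) \<inter> above e)"
proof
  fix f assume f: "f \<in> X \<inter> above e"
  show "f \<in> closure ((B - S) \<inter> above e)"
  proof (cases "f \<in> B - S")
    case True
    then show ?thesis
      using f subset_closure[of "(B - S) \<inter> above e"] above_subset_ground by blast
  next
    case False
    then have "f \<in> closure ((B - S) \<inter> above f)"
      using f X Ext_act_closure by blast
    moreover have "(B - S) \<inter> above f \<subseteq> (B - S) \<inter> above e"
      using f above_trans by blast
    ultimately show ?thesis
      using closure_mono by blast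
  qed
qed

lemma X_closure: "X \<subseteq> closure (B - S)"
proof
  fix f assume "f \<in> X"
  then show "f \<in> closure (B - S)"
    using X Ext_act_closure[of f] closure_mono[of "(B - S) \<inter> above f" "B - S"]
      subset_closure[of "B - S"] basis_subset_ground[OF B] by blast
qed

lemma closure_X_above: "closure (X \<inter> above e) \<subseteq> closure ((B - S) \<inter> above e)"
  by (rule closure_closure_subset[OF _ X_above_closure]) (use above_subset_ground in blast)

text \<open>An active \<open>e\<close> would be spanned by the larger elements of \<open>B\<close>.
  Outside \<open>B\<close> this makes \<open>e\<close> externally active for \<open>B\<close> and
  hence a member of \<open>X\<close>; inside \<open>B\<close> it contradicts independence.\<close>

lemma Ext_act_X_empty: "Ext_act M le X = {}"
proof -
  have False if "e \<in> Ext_act M le X" for e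
  proof -
    have e: "e \<in> ground M" "e \<notin> X" "e \<in> closure ((B - S) \<inter> above e)"
      using that mem_Ext_act_iff closure_X_above by blast+
    have "e \<in> closure (B \<inter> above e)"
      using e(3) closure_mono[of "(B - S) \<inter> above e" "B \<inter> above e"] by blast
    then have "e \<in> B"
      using e mem_Ext_act_iff X by blast
    moreover have "e \<notin> B \<inter> above e"
      by (simp add: above_def)
    ultimately show False
      using indep_not_in_closure[OF basis_indep[OF B], of e "B \<inter> above e"] \<open>e \<in> closure (B \<inter> above e)\<close>
      by blast
  qed
  then show ?thesis
    by blast
qed

text \<open>Recovers \<open>B - S\<close> from \<open>X\<close> alone: the elements of
  \<open>Ext_act M le B\<close> are spanned by larger elements of \<open>B - S\<close>, while
  independence rules this out for \<open>B - S\<close> itself.\<close>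

lemma greedy_in_X: "{e \<in> X. e \<notin> closure (X \<inter> above e)} = B - S"
proof (intro equalityI subsetI)
  fix e assume e: "e \<in> {e \<in> X. e \<notin> closure (X \<inter> above e)}"
  show "e \<in> B - S"
  proof (rule ccontr)
    assume "e \<notin> B - S"
    then have "e \<in> closure ((B - S) \<inter> above e)"
      using e X Ext_act_closure by blast
    moreover have "(B - S) \<inter> above e \<subseteq> X \<inter> above e"
      using X by blast
    ultimately show False
      using e closure_mono by blast
  qed
next
  fix e assume e: "e \<in> B - S"
  have "e \<notin> (B - S) \<inter> above e"
    by (simp add: above_def)
  then have "e \<notin> closure ((B - S) \<inter> above e)"
    using indep_not_in_closure[OF basis_indep[OF B], of e "(B - S) \<inter> above e"] e by blast
  then show "e \<in> {e \<in> X. e \<notin> closure (X \<inter> above e)}"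
    using e X closure_X_above by blast
qed

text \<open>Recovers \<open>S\<close> from \<open>X\<close> alone. For \<open>e\<close> in
  \<open>S\<close>, the set \<open>(B - {e}) \<union> below e\<close> spans \<open>X\<close> because
  it contains \<open>B - S\<close>, yet it does not span the internally active
  \<open>e\<close>.\<close>

lemma greedy_outside_X: "{e \<in> ground M - X. e \<notin> closure (X \<union> below e)} = S"
proof (intro equalityI subsetI)
  fix e assume e: "e \<in> S"
  have eB: "e \<in> B" "e \<notin> closure ((B - {e}) \<union> below e)"
    using e S mem_Int_act_iff[OF B] by blast+
  let ?F = "(B - {e}) \<union> below e"
  have F: "?F \<subseteq> ground M"
    using basis_subset_ground[OF B] below_subset_ground by blast
  have "B - S \<subseteq> ?F"
    using e by blast
  then have "X \<union> below e \<subseteq> closure ?F"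
    using X_closure closure_mono[of "B - S" ?F] subset_closure[OF F] by blast
  then have "e \<notin> closure (X \<union> below e)"
    using closure_closure_subset[OF F] eB(2) by blast
  moreover have "e \<in> ground M - X"
    using eB e X basis_subset_ground[OF B] Ext_act_disjoint by blast
  ultimately show "e \<in> {e \<in> ground M - X. e \<notin> closure (X \<union> below e)}"
    by blast
next
  fix e assume e: "e \<in> {e \<in> ground M - X. e \<notin> closure (X \<union> below e)}"
  show "e \<in> S"
  proof (rule ccontr)
    assume "e \<notin> S"
    then have "e \<notin> B"
      using e X by blast
    then obtain C where C: "circuit M C" "e \<in> C" "C - {e} \<subseteq> B"
      using closureE[of e B] basis_spanning[OF B] e by blast
    \<comment> \<open>If \<open>e\<close> were smaller than \<open>f\<close>, the circuit
      \<open>C\<close> would put \<open>f\<close> in the closure of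
      \<open>(B - {f}) \<union> below f\<close>, against internal activity of \<open>f\<close>. So
      \<open>C\<close> shows that \<open>X \<union> below e\<close> spans \<open>e\<close>.\<close>
    have "f \<in> below e" if f: "f \<in> C - {e}" "f \<in> S" for f
    proof (rule ccontr)
      assume "f \<notin> below e"
      then have "e \<in> below f"
        using above_or_below[of e f] below_iff_above[of f e] f e circuit_subset_ground[OF C(1)]
        by blast
      then have "C - {f} \<subseteq> (B - {f}) \<union> below f"
        using C(3) by blast
      then have "f \<in> closure ((B - {f}) \<union> below f)"
        using circuit_in_closure[OF C(1)] f(1) by blast
      then show False
        using f(2) S mem_Int_act_iff[OF B] by blast
    qed
    then have "C - {e} \<subseteq> X \<union> below e"
      using C(3) X by blast
    then show False
      using circuit_in_closure[OF C(1,2)] e by blast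
  qed
qed

lemma basis_restriction_X: "basis (restriction M X) (B \<inter> X)"
proof -
  have BX: "B \<inter> X = B - S"
    using X S_subset Ext_act_disjoint by blast
  moreover have "B - S \<in> indeps M"
    using indep_subset[OF basis_indep[OF B]] by blast
  moreover have "B - S \<subseteq> X"
    using X by blast
  ultimately show ?thesis
    using basis_restriction_if_spanning[OF _ _ X_closure] by simp
qed

lemma rank_contraction_X: "rank (contraction M X) = card S"
proof -
  have "B - X = S"
    using X S_subset Ext_act_disjoint by blast
  then show ?thesis
    using rank_contraction[OF X_subset B basis_restriction_X] by simp
qed

lemma rank_dual_restriction_X: "rank (dual (restriction M X)) = card (Ext_act M le B)"
proof -
  have "X - (B \<inter> X) = Ext_act M le B"
    using X Ext_act_disjoint by blast
  then show ?thesis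
    using matroid.rank_dual[OF matroid_restriction[OF X_subset] basis_restriction_X] by simp
qed

end

section \<open>From a compatible set to a basis\<close>

context
  fixes X P Q
  assumes X: "X \<subseteq> ground M" and Ext_act_X: "Ext_act M le X = {}"
  defines P: "P \<equiv> {e \<in> X. e \<notin> closure (X \<inter> above e)}"
    and Q: "Q \<equiv> {e \<in> ground M - X. e \<notin> closure (X \<union> below e)}"
begin

text \<open>The minimum of a circuit inside \<open>P\<close> would be spanned by larger elements of
  \<open>X\<close>.\<close>

lemma P_indep: "P \<in> indeps M"
proof (rule ccontr)
  assume "P \<notin> indeps M"
  then obtain C where C: "circuit M C" "C \<subseteq> P"
    using ex_circuit[of P] X P by blast
  have "C \<noteq> {}"
    using C(1) empty_indep unfolding circuit_def by blast
  then obtain e where e: "e \<in> C" "C - {e} \<subseteq> above e"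
    using ex_le_minimum[OF circuit_subset_ground[OF C(1)]] by blast
  then have "C - {e} \<subseteq> X \<inter> above e"
    using C(2) P by blast
  then have "e \<in> closure (X \<inter> above e)"
    by (rule circuit_in_closure[OF C(1) e(1)])
  then show False
    using C(2) P e(1) by blast
qed

lemma P_subset_ground: "P \<subseteq> ground M"
  using X P by blast

text \<open>Induction from the largest element down: the largest counterexample \<open>m\<close> is
  not in \<open>P\<close>, so larger elements of \<open>X\<close> span it, and for these the claim
  holds. The \<open>insert\<close> accommodates the case that \<open>f\<close> itself is in
  \<open>P\<close>.\<close>

lemma X_closure_P_insert: "f \<in> X \<Longrightarrow> f \<in> closure (P \<inter> insert f (above f))"
proof (rule ccontr)
  assume f: "f \<in> X" "f \<notin> closure (P \<inter> insert f (above f))"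
  let ?bad = "{f \<in> X. f \<notin> closure (P \<inter> insert f (above f))}"
  obtain m where m: "m \<in> ?bad" "?bad - {m} \<subseteq> below m"
    using ex_le_maximum[of ?bad] X f by blast
  have sub: "P \<inter> insert m (above m) \<subseteq> ground M"
    using P_subset_ground by blast
  then have "m \<notin> P"
    using m(1) subset_closure by blast
  then have "m \<in> closure (X \<inter> above m)"
    using m(1) P by blast
  moreover have "X \<inter> above m \<subseteq> closure (P \<inter> insert m (above m))"
  proof
    fix g assume g: "g \<in> X \<inter> above m"
    then have "g \<noteq> m"
      by (simp add: above_def)
    then have "g \<in> closure (P \<inter> insert g (above g))"
      using g m(2) above_not_below by blast
    moreover have "P \<inter> insert g (above g) \<subseteq> P \<inter> insert m (above m)"
      using g above_trans by blast
    ultimately show "g \<in> closure (P \<inter> insert m (above m))"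
      using closure_mono by blast
  qed
  ultimately show False
    using closure_closure_subset[OF sub] m(1) by blast
qed

lemma X_above_closure_P: "X \<inter> above e \<subseteq> closure (P \<inter> above e)"
proof
  fix f assume f: "f \<in> X \<inter> above e"
  then have "P \<inter> insert f (above f) \<subseteq> P \<inter> above e"
    using above_trans by blast
  then show "f \<in> closure (P \<inter> above e)"
    using X_closure_P_insert[of f] f closure_mono by blast
qed

lemma X_subset_closure_P: "X \<subseteq> closure P"
  using X_closure_P_insert closure_mono[OF Int_lower1] by blast

text \<open>Otherwise \<open>C\<close> would show that the largest element \<open>m\<close> of \<open>C \<inter> Q\<close> is spanned by \<open>X \<union> below m\<close>.\<close>

lemma circuit_meets_Q:
  assumes C: "circuit M C" and f: "f \<in> C" "f \<in> Q"
  obtains g where "g \<in> C" "g \<notin> X" "g \<notin> Q" "g \<in> above f"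
proof -
  obtain m where m: "m \<in> C \<inter> Q" "C \<inter> Q - {m} \<subseteq> below m"
    using ex_le_maximum[of "C \<inter> Q"] f Q by blast
  have ground: "m \<in> ground M" "f \<in> ground M"
    using m(1) f Q by blast+
  have "m \<notin> closure (X \<union> below m)"
    using m(1) Q by blast
  then obtain g where g: "g \<in> C - {m}" "g \<notin> X \<union> below m"
    using circuit_in_closure[OF C, of m "X \<union> below m"] m(1) by blast
  then have "g \<notin> Q"
    using m(2) by blast
  moreover have "g \<in> above m"
    using g above_or_below[OF ground(1), of g] circuit_subset_ground[OF C] by blast
  moreover have "m = f \<or> m \<in> above f"
    using m(2) f below_iff_above ground by blast
  ultimately show ?thesis
    using that[of g] g above_trans by blast
qed

text \<open>A circuit inside \<open>P \<union> Q\<close> must meet \<open>Q\<close>, and then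
  \<open>circuit_meets_Q\<close> gives it an element outside both \<open>X\<close> and
  \<open>Q\<close>; but \<open>P\<close> lies in \<open>X\<close>.\<close>

lemma PQ_indep: "P \<union> Q \<in> indeps M"
proof (rule ccontr)
  assume "P \<union> Q \<notin> indeps M"
  then obtain C where C: "circuit M C" "C \<subseteq> P \<union> Q"
    using ex_circuit[of "P \<union> Q"] X P Q by blast
  show False
  proof (cases "C \<subseteq> P")
    case True
    then show False
      using circuit_not_indep C(1) P_indep by blast
  next
    case False
    then obtain f where "f \<in> C" "f \<in> Q"
      using C(2) by blast
    then show False
      using circuit_meets_Q[OF C(1)] C(2) P by blast
  qed
qed

lemma PQ_subset_ground: "P \<union> Q \<subseteq> ground M"
  using PQ_indep indeps_subset_ground by blast

text \<open>The smallest unspanned element \<open>m\<close> lies in neither \<open>X\<close> nor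
  \<open>Q\<close>, so \<open>X \<union> below m\<close> spans it; all of that set is already
  spanned.\<close>

lemma PQ_spanning: "ground M \<subseteq> closure (P \<union> Q)"
proof (rule ccontr)
  let ?bad = "ground M - closure (P \<union> Q)"
  assume "\<not> ground M \<subseteq> closure (P \<union> Q)"
  then obtain m where m: "m \<in> ?bad" "?bad - {m} \<subseteq> above m"
    using ex_le_minimum[of ?bad] by blast
  have sub: "X \<subseteq> closure (P \<union> Q)"
    using X_subset_closure_P closure_mono[of P "P \<union> Q"] by blast
  have "m \<notin> Q"
    using m(1) subset_closure[OF PQ_subset_ground] by blast
  then have "m \<in> closure (X \<union> below m)"
    using m(1) sub Q by blast
  moreover have "below m \<subseteq> closure (P \<union> Q)"
  proof
    fix g assume g: "g \<in> below m"
    then have "g \<noteq> m"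
      by (simp add: below_def)
    then show "g \<in> closure (P \<union> Q)"
      using g m(2) above_not_below below_subset_ground by blast
  qed
  ultimately show False
    using closure_closure_subset[OF PQ_subset_ground, of "X \<union> below m"] sub m(1) by blast
qed

lemma PQ_basis: "basis M (P \<union> Q)"
proof -
  have "restriction M (ground M) = M"
    by (intro pre_matroid.equality) (use indeps_subset_ground in auto)
  then show ?thesis
    using basis_restriction_if_spanning[OF PQ_indep PQ_subset_ground PQ_spanning] by simp
qed

text \<open>A circuit refuting activity of \<open>f\<close> would, by
  \<open>circuit_meets_Q\<close>, contain some \<open>g\<close> above \<open>f\<close> outside
  \<open>X\<close> and \<open>Q\<close>. Outside \<open>P \<union> Q\<close>, however, that circuit
  has only \<open>f\<close> and elements below \<open>f\<close>.\<close>

lemma Q_subset_Int_act: "Q \<subseteq> Int_act M le (P \<union> Q)"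
proof
  fix f assume f: "f \<in> Q"
  have "f \<notin> closure ((P \<union> Q - {f}) \<union> below f)"
  proof
    assume "f \<in> closure ((P \<union> Q - {f}) \<union> below f)"
    moreover have "f \<notin> (P \<union> Q - {f}) \<union> below f"
      by (simp add: below_def)
    ultimately obtain C where C: "circuit M C" "f \<in> C" "C - {f} \<subseteq> (P \<union> Q - {f}) \<union> below f"
      using closureE by blast
    obtain g where g: "g \<in> C" "g \<notin> X" "g \<notin> Q" "g \<in> above f"
      using circuit_meets_Q[OF C(1,2) f] by blast
    then have "g \<in> below f"
      using C(3) P f by blast
    then show False
      using g(4) above_not_below by blast
  qed
  then show "f \<in> Int_act M le (P \<union> Q)"
    using mem_Int_act_iff[OF PQ_basis] f by blast
qed

text \<open>Elements of \<open>X - P\<close> are spanned by larger elements of \<open>P\<close>.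
  Conversely, an active \<open>e\<close> outside \<open>X\<close> would also be externally active
  for \<open>X\<close>, which \<open>Ext_act_X\<close> excludes.\<close>

lemma Ext_act_PQ: "Ext_act M le (P \<union> Q) = X - P"
proof (intro equalityI subsetI)
  fix e assume e: "e \<in> X - P"
  then have "e \<in> closure (X \<inter> above e)"
    using P by blast
  then have "e \<in> closure (P \<inter> above e)"
    using closure_closure_subset[OF _ X_above_closure_P] P_subset_ground by blast
  then have "e \<in> closure ((P \<union> Q) \<inter> above e)"
    using closure_mono[of "P \<inter> above e" "(P \<union> Q) \<inter> above e"] by blast
  then show "e \<in> Ext_act M le (P \<union> Q)"
    using mem_Ext_act_iff e X Q by blast
next
  fix e assume "e \<in> Ext_act M le (P \<union> Q)"
  then have e: "e \<in> ground M" "e \<notin> P \<union> Q" "e \<in> closure ((P \<union> Q) \<inter> above e)"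
    using mem_Ext_act_iff by blast+
  show "e \<in> X - P"
  proof (rule ccontr)
    assume "e \<notin> X - P"
    then have eX: "e \<notin> X"
      using e(2) by blast
    obtain C where C: "circuit M C" "e \<in> C" "C - {e} \<subseteq> (P \<union> Q) \<inter> above e"
      using closureE[OF e(3)] e(2) by blast
    \<comment> \<open>Otherwise \<open>circuit_meets_Q\<close> gives an element of \<open>C\<close>
      above \<open>f\<close> and outside \<open>X\<close> and \<open>Q\<close>. It can only be
      \<open>e\<close>, but \<open>e\<close> is smaller than \<open>f\<close>.\<close>
    have "C \<inter> Q = {}"
    proof (rule ccontr)
      assume "C \<inter> Q \<noteq> {}"
      then obtain f where f: "f \<in> C" "f \<in> Q"
        by blast
      obtain g where g: "g \<in> C" "g \<notin> X" "g \<notin> Q" "g \<in> above f"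
        using circuit_meets_Q[OF C(1) f] by blast
      then have "g = e"
        using C(3) P by blast
      moreover have "f \<in> above e"
        using f C(3) e(2) by blast
      ultimately show False
        using g(4) above_trans[of f e e] by (simp add: above_def)
    qed
    then have "C - {e} \<subseteq> X \<inter> above e"
      using C(3) P by blast
    then show False
      using circuit_in_closure[OF C(1,2)] mem_Ext_act_iff[of e X] e(1) eX Ext_act_X by blast
  qed
qed

lemma PQ_recovers_X: "(P \<union> Q - Q) \<union> Ext_act M le (P \<union> Q) = X"
  unfolding Ext_act_PQ using P Q by blast

end

end

section \<open>Summation over pairs of a basis and a set of internally active elements\<close>

text \<open>Expand the product of \<open>card A\<close> factors \<open>a + 1\<close>: each subset
  \<open>S\<close> collects the factors from which \<open>a\<close> is chosen. It is used with
  \<open>a = x - 1\<close>.\<close>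

lemma sum_Pow_power_card:
  fixes a :: "'b::comm_ring_1"
  assumes "finite A"
  shows "(\<Sum>S\<in>Pow A. a ^ card S) = (a + 1) ^ card A"
  using prod_add[OF assms, of "\<lambda>_. a" "\<lambda>_. 1"] by simp

theorem corollary11:
  fixes M :: "'a pre_matroid" and le :: "'a rel" and x y :: "'b::comm_ring_1"
  assumes "matroid M" and "linear_order_on (ground M) le"
  shows "tutte M le x y =
    (\<Sum>X\<in>{X. X \<subseteq> ground M \<and> compatible M le (ground M - X)}.
       (x - 1) ^ rank (contraction M X) * y ^ rank (dual (restriction M X)))"
proof -
  interpret matroid M
    by fact
  interpret ordered_matroid M le
    by unfold_locales fact
  define P where "P X = {e \<in> X. e \<notin> closure (X \<inter> above e)}" for X
  define Q where "Q X = {e \<in> ground M - X. e \<notin> closure (X \<union> below e)}" for X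
  let ?bases = "{B. basis M B}"
  let ?XS = "{X. X \<subseteq> ground M \<and> compatible M le (ground M - X)}"
  have fin: "finite ?bases"
    by (rule finite_subset[OF _ finite_indeps]) (auto dest: basis_indep)
  have fin_Int: "finite (Int_act M le B)" if "basis M B" for B
    by (rule finite_subset[of _ B]) (use that basis_indep finite_indep in \<open>auto simp: Int_act_def\<close>)
  have "tutte M le x y =
      (\<Sum>B\<in>?bases. \<Sum>S\<in>Pow (Int_act M le B). (x - 1) ^ card S * y ^ card (Ext_act M le B))"
    unfolding tutte_def
  proof (rule sum.cong[OF refl])
    fix B assume "B \<in> ?bases"
    then show "x ^ card (Int_act M le B) * y ^ card (Ext_act M le B) =
        (\<Sum>S\<in>Pow (Int_act M le B). (x - 1) ^ card S * y ^ card (Ext_act M le B))"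
      using sum_Pow_power_card[OF fin_Int, of B "x - 1"] by (simp flip: sum_distrib_right)
  qed
  also have "\<dots> = (\<Sum>(B, S)\<in>Sigma ?bases (\<lambda>B. Pow (Int_act M le B)).
      (x - 1) ^ card S * y ^ card (Ext_act M le B))"
    by (rule sum.Sigma) (use fin fin_Int in auto)
  also have "\<dots> = (\<Sum>X\<in>?XS. (x - 1) ^ rank (contraction M X) * y ^ rank (dual (restriction M X)))"
  \<comment> \<open>Cases 1 and 3 say that the two maps are mutually inverse, cases 2 and 4 that
    they land in the right index sets, and case 5 that the summands agree.\<close>
  proof (rule sum.reindex_bij_witness[where j = "\<lambda>(B, S). (B - S) \<union> Ext_act M le B"
        and i = "\<lambda>X. (P X \<union> Q X, Q X)"], goal_cases)
    case (1 a)
    then obtain B S where a: "a = (B, S)" "basis M B" "S \<subseteq> Int_act M le B"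
      by auto
    have "B - S \<union> S = B"
      using S_subset[OF a(2,3) refl] by blast
    then show ?case
      using greedy_in_X[OF a(2,3) refl] greedy_outside_X[OF a(2,3) refl]
      by (simp add: a(1) P_def Q_def)
  next
    case (2 a)
    then obtain B S where a: "a = (B, S)" "basis M B" "S \<subseteq> Int_act M le B"
      by auto
    then show ?case
      using X_subset[OF a(2,3) refl] Ext_act_X_empty[OF a(2,3) refl] compatible_compl_iff
      by simp
  next
    case (3 X)
    then have X: "X \<subseteq> ground M" "Ext_act M le X = {}"
      using compatible_compl_iff by auto
    show ?case
      using PQ_recovers_X[OF X] by (simp add: P_def Q_def)
  next
    case (4 X)
    then have X: "X \<subseteq> ground M" "Ext_act M le X = {}"
      using compatible_compl_iff by auto
    show ?case
      using PQ_basis[OF X] Q_subset_Int_act[OF X] by (simp add: P_def Q_def)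
  next
    case (5 a)
    then obtain B S where a: "a = (B, S)" "basis M B" "S \<subseteq> Int_act M le B"
      by auto
    show ?case
      using rank_contraction_X[OF a(2,3) refl] rank_dual_restriction_X[OF a(2,3) refl]
      by (simp add: a(1))
  qed
  finally show ?thesis .
qed

end
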